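(* There exists an absolute constant $C$ such that for every integer $n\ge 2$ there is a number $c_n$ with $|c_n|\le C$ and $\gamma_{LLg}(P_n)=\frac{4n}{5}+c_n$.
   Context: $P_n$ denotes the path graph on $n$ vertices. For a vertex $v$ of a graph $G$, $N(v)$ is its open neighborhood and $N[v]=N(v)\cup\{v\}$ its closed neighborhood. In the LL-domination game on a finite graph $G$ without isolated vertices two players, Dominator and Staller, alternately select a vertex of $G$, with Dominator moving first. In the $i$-th move, after the moves $v_1,\dots,v_{i-1}$, the choice of a vertex $v_i$ is legal if $N[v_i]\setminus\bigcup_{j=1}^{i-1}N(v_j)\neq\emptyset$ (a vertex may be selected repeatedly as long as this holds). The game ends when no legal move is available; its length is the total number of moves played (an unending play has infinite length). Dominator wants to minimize the length, Staller wants to maximize it. The number $\gamma_{LLg}(G)$ is the length of the game under optimal play by both players. *)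

theory Defs
  imports Complex_Main "HOL-Library.Extended_Nat" "HOL-Library.Extended_Real"
begin

locale isolate_free_graph =
  fixes V :: "'a set" and E :: "'a set set"
  assumes finite_verts: "finite V"
    and edge_subset: "e \<in> E \<Longrightarrow> e \<subseteq> V"
    and edge_card: "e \<in> E \<Longrightarrow> card e = 2"
    and no_isolated: "v \<in> V \<Longrightarrow> \<exists>e\<in>E. v \<in> e"
begin

definition open_nbh :: "'a \<Rightarrow> 'a set" where
  "open_nbh v = {u. {v, u} \<in> E}"

definition closed_nbh :: "'a \<Rightarrow> 'a set" where
  "closed_nbh v = insert v (open_nbh v)"

text \<open>A position of the LL-domination game is the list of moves made so far, oldest move first.\<close>

definition legal_move :: "'a list \<Rightarrow> 'a \<Rightarrow> bool" where
  "legal_move h v \<longleftrightarrow> v \<in> V \<and> closed_nbh v - (\<Union>w\<in>set h. open_nbh w) \<noteq> {}"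

definition legal_position :: "'a list \<Rightarrow> bool" where
  "legal_position h \<longleftrightarrow> (\<forall>i<length h. legal_move (take i h) (h ! i))"

text \<open>Strategies may depend on the whole history. The same set serves both players: in a play,
  each strategy is consulted only at the positions where its owner is to move.\<close>

definition strategies :: "('a list \<Rightarrow> 'a) set" where
  "strategies =
    {s. \<forall>h. legal_position h \<and> (\<exists>v. legal_move h v) \<longrightarrow> legal_move h (s h)}"

text \<open>The position after \<open>n\<close> moves, or the final position if the game is over by then;
  Dominator (strategy \<open>d\<close>) makes the first move.\<close>

primrec play :: "('a list \<Rightarrow> 'a) \<Rightarrow> ('a list \<Rightarrow> 'a) \<Rightarrow> nat \<Rightarrow> 'a list" where
  "play d s 0 = []"
| "play d s (Suc n) =
    (let h = play d s n in
     if \<exists>v. legal_move h v then h @ [if even (length h) then d h else s h] else h)"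

definition play_length :: "('a list \<Rightarrow> 'a) \<Rightarrow> ('a list \<Rightarrow> 'a) \<Rightarrow> enat" where
  "play_length d s = (SUP n. enat (length (play d s n)))"

text \<open>A move may be repeated without covering a new vertex, so plays can be infinite. Dominator
  can however always choose a neighbour of an uncovered vertex, so the infimum below is finite, and
  exchanging infimum and supremum gives the same value (determinacy of games of bounded length).\<close>

definition LL_game_number :: enat where
  "LL_game_number = (INF d\<in>strategies. SUP s\<in>strategies. play_length d s)"

end

definition path_verts :: "nat \<Rightarrow> nat set" where
  "path_verts n = {1..n}"

definition path_edges :: "nat \<Rightarrow> nat set set" where
  "path_edges n = {{i, i + 1} | i. 1 \<le> i \<and> i + 1 \<le> n}"

lemma isolate_free_path:
  assumes "n \<ge> 2"
  shows "isolate_free_graph (path_verts n) (path_edges n)"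
proof
  show "finite (path_verts n)" by (simp add: path_verts_def)
  show "e \<subseteq> path_verts n" if "e \<in> path_edges n" for e
    using that by (auto simp: path_verts_def path_edges_def)
  show "card e = 2" if "e \<in> path_edges n" for e
    using that by (auto simp: path_edges_def)
  show "\<exists>e\<in>path_edges n. v \<in> e" if v: "v \<in> path_verts n" for v
  proof (cases "v = n")
    case True
    then have "{n - 1, n - 1 + 1} \<in> path_edges n"
      using assms unfolding path_edges_def by (intro CollectI exI[of _ "n - 1"]) auto
    then show ?thesis using True assms by (intro bexI) auto
  next
    case False
    then have "{v, v + 1} \<in> path_edges n"
      using v unfolding path_edges_def path_verts_def by (intro CollectI exI[of _ v]) auto
    then show ?thesis by (intro bexI) auto
  qed
qed

definition gamma_LLg_path :: "nat \<Rightarrow> enat" where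
  "gamma_LLg_path n = isolate_free_graph.LL_game_number (path_verts n) (path_edges n)"

end

theory Submission imports Defs begin

text \<open>Lower bound: whenever an undominated vertex has only dominated neighbours, Staller passes by
  selecting it. Otherwise she selects a dominated vertex with exactly one undominated neighbour,
  which dominates a single new vertex and creates no gap of length one between undominated
  vertices. After that, a move of Dominator covering two vertices \<open>y - 1\<close>, \<open>y + 1\<close> must leave \<open>y\<close>
  undominated between them, so she can pass next. Hence, up to a constant, five vertices cost four
  moves.

  Upper bound: cut the path into blocks of five vertices. The undominated part of a block weighs
  \<open>0\<close> if it is empty, \<open>1\<close> if it fits into a pair at distance at most two, and \<open>2\<close> otherwise. Each
  legal move of Staller touches some block, and Dominator has a reply after which the
  weight of that block has dropped by at least one, so two moves are spent per unit of weight.\<close>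

section \<open>The game in terms of its uncovered vertices\<close>

context isolate_free_graph
begin

declare play.simps(2) [simp del]

text \<open>All that a history contributes to legality and to later positions is this set, so both
  strategies are analysed on sets of vertices.\<close>

definition uncovered :: "'a list \<Rightarrow> 'a set" where
  "uncovered h = V - (\<Union>w\<in>set h. open_nbh w)"

lemma uncovered_subset: "uncovered h \<subseteq> V"
  by (auto simp: uncovered_def)

lemma uncovered_Nil [simp]: "uncovered [] = V"
  by (simp add: uncovered_def)

lemma uncovered_snoc: "uncovered (h @ [v]) = uncovered h - open_nbh v"
  by (auto simp: uncovered_def)

lemma open_nbh_subset: "open_nbh v \<subseteq> V"
  using edge_subset by (auto simp: open_nbh_def)

lemma open_nbh_sym: "u \<in> open_nbh v \<longleftrightarrow> v \<in> open_nbh u"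
  by (simp add: open_nbh_def insert_commute)

lemma ex_neighbour:
  assumes "v \<in> V"
  shows "\<exists>u\<in>V. v \<in> open_nbh u"
proof -
  obtain e where e: "e \<in> E" "v \<in> e" using no_isolated[OF assms] by blast
  obtain a b where ab: "e = {a, b}" using edge_card[OF e(1)] by (auto simp: card_2_iff)
  then have "v = a \<and> {b, v} \<in> E \<or> v = b \<and> {a, v} \<in> E"
    using e by (auto simp: insert_commute)
  then show ?thesis using edge_subset[OF e(1)] ab by (auto simp: open_nbh_def)
qed

lemma legal_move_iff:
  "legal_move h v \<longleftrightarrow> v \<in> V \<and> closed_nbh v \<inter> uncovered h \<noteq> {}"
  using open_nbh_subset unfolding legal_move_def closed_nbh_def uncovered_def by blast

text \<open>An uncovered vertex is itself a legal choice, because legality looks at the closed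
  neighbourhood.\<close>

lemma ex_legal_move_iff: "(\<exists>v. legal_move h v) \<longleftrightarrow> uncovered h \<noteq> {}"
  using uncovered_subset[of h] by (auto simp: legal_move_iff closed_nbh_def)

lemma strategiesI:
  assumes "\<And>h. uncovered h \<noteq> {} \<Longrightarrow> legal_move h (s h)"
  shows "s \<in> strategies"
  using assms by (auto simp: strategies_def simp flip: ex_legal_move_iff)

lemma legal_position_snoc:
  "legal_position h \<Longrightarrow> legal_move h v \<Longrightarrow> legal_position (h @ [v])"
  by (auto simp: legal_position_def less_Suc_eq nth_append)

lemma play_over: "uncovered (play d s k) = {} \<Longrightarrow> play d s (Suc k) = play d s k"
  by (simp add: play.simps(2) Let_def ex_legal_move_iff)

lemma play_Suc_eq:
  "uncovered (play d s k) \<noteq> {} \<Longrightarrow> play d s (Suc k) =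
    play d s k @ [if even (length (play d s k)) then d (play d s k) else s (play d s k)]"
  by (simp add: play.simps(2) Let_def ex_legal_move_iff)

lemma legal_move_strategy:
  "t \<in> strategies \<Longrightarrow> legal_position h \<Longrightarrow> uncovered h \<noteq> {} \<Longrightarrow> legal_move h (t h)"
  by (simp add: strategies_def ex_legal_move_iff)

lemma legal_position_play:
  assumes "d \<in> strategies" "s \<in> strategies"
  shows "legal_position (play d s k)"
proof (induction k)
  case 0
  then show ?case by (simp add: legal_position_def)
next
  case (Suc k)
  show ?case
  proof (cases "uncovered (play d s k) = {}")
    case True
    then show ?thesis using Suc by (simp only: play_over)
  next
    case False
    then have "legal_move (play d s k) (d (play d s k))" "legal_move (play d s k) (s (play d s k))"
      using Suc assms by (auto intro: legal_move_strategy)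
    then show ?thesis
      using Suc False by (simp add: play_Suc_eq legal_position_snoc)
  qed
qed

lemma length_play_mono: "i \<le> j \<Longrightarrow> length (play d s i) \<le> length (play d s j)"
  by (induction j rule: dec_induct) (auto simp: play.simps(2) Let_def)

lemma LL_game_number_leI:
  assumes "d \<in> strategies"
    and "\<And>s k. s \<in> strategies \<Longrightarrow> length (play d s k) \<le> N"
  shows "LL_game_number \<le> enat N"
  unfolding LL_game_number_def play_length_def
  by (rule INF_lower2[OF assms(1)]) (auto intro!: SUP_least simp: assms(2))

lemma LL_game_number_geI:
  assumes "s \<in> strategies"
    and "\<And>d. d \<in> strategies \<Longrightarrow> \<exists>k. N \<le> length (play d s k)"
  shows "enat N \<le> LL_game_number"
  unfolding LL_game_number_def
proof (rule INF_greatest)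
  fix d assume "d \<in> strategies"
  then obtain k where "N \<le> length (play d s k)" using assms(2) by blast
  then have "enat N \<le> play_length d s"
    unfolding play_length_def by (intro SUP_upper2[of k]) auto
  also have "\<dots> \<le> (SUP s\<in>strategies. play_length d s)"
    by (rule SUP_upper[OF assms(1)])
  finally show "enat N \<le> (SUP s\<in>strategies. play_length d s)" .
qed

text \<open>Dominator's first move is not used; he then keeps minimizing the potential \<open>W\<close>.\<close>

lemma LL_game_number_le_potential:
  fixes W :: "'a set \<Rightarrow> nat"
  assumes mono: "\<And>A B. A \<subseteq> B \<Longrightarrow> B \<subseteq> V \<Longrightarrow> W A \<le> W B"
    and reply: "\<And>U x. U \<subseteq> V \<Longrightarrow> x \<in> V \<Longrightarrow> closed_nbh x \<inter> U \<noteq> {} \<Longrightarrow>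
      \<exists>y\<in>V. W (U - open_nbh x - open_nbh y) < W U"
  shows "LL_game_number \<le> enat (2 * W V + 1)"
proof -
  define d where
    "d h = (ARG_MIN (\<lambda>v. W (uncovered h - open_nbh v)) v. legal_move h v)" for h
  have d_legal: "legal_move h (d h)"
    and d_min: "legal_move h v \<Longrightarrow> W (uncovered h - open_nbh (d h)) \<le> W (uncovered h - open_nbh v)"
    if nonempty: "uncovered h \<noteq> {}" for h v
  proof -
    obtain v0 where "legal_move h v0" using nonempty ex_legal_move_iff[of h] by auto
    note * = arg_min_nat_lemma[of "legal_move h", OF this, of "\<lambda>v. W (uncovered h - open_nbh v)",
        folded d_def]
    show "legal_move h (d h)" using * by blast
    show "legal_move h v \<Longrightarrow> W (uncovered h - open_nbh (d h)) \<le> W (uncovered h - open_nbh v)"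
      using * by blast
  qed
  have d: "d \<in> strategies" by (rule strategiesI) (rule d_legal)
  show ?thesis
  proof (rule LL_game_number_leI[OF d])
    fix s k assume s: "s \<in> strategies"
    let ?p = "play d s"
    \<comment> \<open>Sampled when Staller is to move: her move and the reply add at most two to the
      length and lower \<open>W\<close> by at least one. The alternative to odd length is a play
      that has ended.\<close>
    have inv: "(odd (length (?p (2 * m + 1))) \<or> uncovered (?p (2 * m + 1)) = {}) \<and>
        length (?p (2 * m + 1)) + 2 * W (uncovered (?p (2 * m + 1))) \<le> 2 * W V + 1" for m
    proof (induction m)
      case 0
      have "odd (length (?p 1)) \<or> uncovered (?p 1) = {}" "length (?p 1) \<le> 1"
        by (auto simp: play.simps(2) Let_def ex_legal_move_iff simp del: uncovered_Nil)
      moreover have "W (uncovered (?p 1)) \<le> W V" by (rule mono[OF uncovered_subset]) simp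
      ultimately show ?case by simp
    next
      case (Suc m)
      define h where "h = ?p (2 * m + 1)"
      have two: "2 * Suc m + 1 = Suc (Suc (2 * m + 1))" by simp
      show ?case
      proof (cases "uncovered h = {}")
        case True
        then have "?p (2 * Suc m + 1) = h"
          unfolding two h_def by (metis play_over)
        then show ?thesis using Suc True by (simp add: h_def)
      next
        case False
        define x where "x = s h"
        define h1 where "h1 = h @ [x]"
        have odd: "odd (length h)" using Suc False by (simp add: h_def)
        have p1: "?p (Suc (2 * m + 1)) = h1"
          using odd False play_Suc_eq[of d s "2 * m + 1"] by (simp add: h_def h1_def x_def)
        have "legal_move h x"
          unfolding x_def h_def
          by (rule legal_move_strategy[OF s legal_position_play[OF d s]])
            (use False h_def in simp)
        then obtain y where y: "y \<in> V" "W (uncovered h1 - open_nbh y) < W (uncovered h)"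
          using reply[OF uncovered_subset, of x h] by (auto simp: legal_move_iff h1_def uncovered_snoc)
        show ?thesis
        proof (cases "uncovered h1 = {}")
          case True
          then have "?p (2 * Suc m + 1) = h1" unfolding two using p1 play_over by metis
          moreover have "W {} < W (uncovered h)" using y True by simp
          moreover have "length h1 = length h + 1" by (simp add: h1_def)
          ultimately show ?thesis using Suc True by (simp add: h_def)
        next
          case False
          have p2: "?p (2 * Suc m + 1) = h1 @ [d h1]"
            unfolding two using p1 False odd play_Suc_eq[of d s "Suc (2 * m + 1)"]
            by (simp add: h1_def)
          have "W (uncovered h1 - open_nbh (d h1)) \<le> W (uncovered h1 - open_nbh y)"
          proof (cases "legal_move h1 y")
            case True
            then show ?thesis by (rule d_min[OF False])
          next
            \<comment> \<open>The promised reply \<open>y\<close> may be illegal after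
              \<open>x\<close>; it then covers nothing, and by monotonicity every move does at least
              as well.\<close>
            case illegal: False
            then have "uncovered h1 - open_nbh y = uncovered h1"
              using y by (auto simp: legal_move_iff closed_nbh_def)
            then show ?thesis using uncovered_subset by (auto intro!: mono)
          qed
          then have "W (uncovered (h1 @ [d h1])) < W (uncovered h)"
            using y by (simp add: uncovered_snoc)
          then show ?thesis using Suc p2 odd by (simp add: h_def h1_def)
        qed
      qed
    qed
    have "length (?p k) \<le> length (?p (2 * k + 1))" by (rule length_play_mono) simp
    then show "length (?p k) \<le> 2 * W V + 1" using inv[of k] by linarith
  qed
qed

end

section \<open>The path as a board\<close>

locale path_game =
  fixes n :: nat
  assumes two_le: "2 \<le> n"

sublocale path_game \<subseteq> isolate_free_graph "path_verts n" "path_edges n"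
  using two_le by (rule isolate_free_path)

context path_game
begin

lemma mem_open_nbh_iff:
  "u \<in> open_nbh v \<longleftrightarrow> u \<in> path_verts n \<and> v \<in> path_verts n \<and> (u = v + 1 \<or> v = u + 1)"
  unfolding open_nbh_def unfolding path_edges_def path_verts_def
  by (auto simp: doubleton_eq_iff)

text \<open>At an end of the path, \<open>v - 1\<close> is 0 or \<open>v + 1\<close> is
  \<open>n + 1\<close>, which is outside \<open>U\<close>; so the ends need no separate
  treatment.\<close>

lemma Diff_open_nbh:
  "U \<subseteq> path_verts n \<Longrightarrow> v \<in> path_verts n \<Longrightarrow> U - open_nbh v = U - {v - 1, v + 1}"
  by (auto simp: mem_open_nbh_iff path_verts_def)

end

subsection \<open>Dominator's strategy\<close>

definition block :: "nat \<Rightarrow> nat set" where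
  "block j = {5 * j + 1..5 * j + 5}"

text \<open>Bounds the number of rounds, each a Staller move touching the block and a suitable
  reply, that clear it. Value 1 goes to pairs at distance one or two because such a pair is always
  cleared in one round.\<close>

definition weight :: "nat set \<Rightarrow> nat" where
  "weight X = (if X = {} then 0 else if \<exists>a. X \<subseteq> {a, a + 1} \<or> X \<subseteq> {a, a + 2} then 1 else 2)"

lemma weight_mono: "X \<subseteq> Y \<Longrightarrow> weight X \<le> weight Y"
  unfolding weight_def by (auto; blast)

lemma weight_le_2: "weight X \<le> 2"
  by (simp add: weight_def)

lemma weight_le_1I: "X \<subseteq> {a, a + 1} \<or> X \<subseteq> {a, a + 2} \<Longrightarrow> weight X \<le> 1"
  by (auto simp: weight_def)

context path_game
begin

text \<open>The block is that of an uncovered vertex \<open>a\<close> which \<open>x\<close> covers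
  or, if \<open>x\<close> covers nothing, of \<open>a = x\<close>. At weight 1 the reply clears it;
  at weight 2 the reply, found by checking the offset of \<open>a\<close>, leaves at most a pair at
  distance one or two.\<close>

lemma block_reply:
  assumes U: "U \<subseteq> path_verts n" and x: "x \<in> path_verts n"
    and meet: "closed_nbh x \<inter> U \<noteq> {}"
  shows "\<exists>j<(n + 4) div 5. \<exists>y\<in>path_verts n.
    weight ((U - open_nbh x - open_nbh y) \<inter> block j) < weight (U \<inter> block j)"
proof -
  obtain a where a: "a \<in> U" "a \<in> open_nbh x \<or> a = x \<and> open_nbh x \<inter> U = {}"
    using meet by (auto simp: closed_nbh_def)
  define j where "j = (a - 1) div 5"
  have a_n: "1 \<le> a" "a \<le> n" using a U by (auto simp: path_verts_def)
  have j: "j < (n + 4) div 5" using a_n unfolding j_def by linarith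
  define X where "X = U \<inter> block j"
  have aX: "a \<in> X" using a a_n by (auto simp: X_def block_def j_def)
  have Xn: "X \<subseteq> {1..n}" using U by (auto simp: X_def path_verts_def)
  define R where "R y = (U - {x - 1, x + 1} - {y - 1, y + 1}) \<inter> block j" for y
  have R: "(U - open_nbh x - open_nbh y) \<inter> block j = R y" if "y \<in> path_verts n" for y
    using U x that Diff_open_nbh[OF U x] Diff_open_nbh[of "U - open_nbh x" y]
    by (auto simp: R_def)
  have x_n: "1 \<le> x" "x \<le> n" using x by (auto simp: path_verts_def)
  have move_cases: "a = x + 1 \<or> x = a + 1 \<or> a = x \<and> x - 1 \<notin> U \<and> x + 1 \<notin> U"
    using a(2)
  proof
    assume "a = x \<and> open_nbh x \<inter> U = {}"
    then have "a = x" and *: "\<And>u. u \<in> open_nbh x \<Longrightarrow> u \<notin> U" by auto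
    moreover have "x - 1 \<notin> U" "x + 1 \<notin> U"
      using *[of "x - 1"] *[of "x + 1"] U x by (auto simp: mem_open_nbh_iff path_verts_def)
    ultimately show ?thesis by auto
  qed (auto simp: mem_open_nbh_iff)
  have "\<exists>y\<in>path_verts n. weight (R y) < weight X"
  proof (cases "\<exists>b. X \<subseteq> {b, b + 1} \<or> X \<subseteq> {b, b + 2}")
    case True
    then have w: "weight X = 1" using aX by (auto simp: weight_def)
    obtain b e where "X \<subseteq> {b, e}" "e = b + 1 \<or> e = b + 2" using True by blast
    then obtain q where q: "X \<subseteq> {a, q}" "q = a + 1 \<or> a = q + 1 \<or> q = a + 2 \<or> a = q + 2"
      using aX by blast
    obtain p where p: "X \<subseteq> {a, p}" "p \<in> X" "p = a \<or> p = a + 1 \<or> a = p + 1 \<or> p = a + 2 \<or> a = p + 2"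
    proof (cases "q \<in> X")
      case True
      then show ?thesis using q that by blast
    next
      case False
      then show ?thesis using q aX that[of a] by blast
    qed
    have pU: "p \<in> U" "p \<in> path_verts n" using p U by (auto simp: X_def)
    have "\<exists>y\<in>path_verts n. a \<notin> R y \<and> p \<notin> R y"
    \<comment> \<open>If \<open>x = a\<close> was a pass, then \<open>p\<close> is not adjacent to
      \<open>a\<close>, so it is at distance two and the vertex between covers both. Otherwise
      \<open>x\<close> has covered \<open>a\<close>, or \<open>p = a\<close>, and any neighbour of
      \<open>p\<close> will do.\<close>
    proof (cases "x = a \<and> p \<noteq> a")
      case True
      then have "p = a + 2 \<or> a = p + 2" using p move_cases pU by auto
      then obtain y where "y = a + 1 \<and> p = y + 1 \<or> y + 1 = a \<and> y = p + 1"
        by (metis add.assoc one_add_one)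
      then show ?thesis using pU a_n by (intro bexI[of _ y]) (auto simp: R_def path_verts_def)
    next
      case False
      obtain y where "y \<in> path_verts n" "p \<in> open_nbh y" using ex_neighbour pU by blast
      then show ?thesis using False move_cases
        by (intro bexI[of _ y]) (auto simp: R_def mem_open_nbh_iff)
    qed
    then have "\<exists>y\<in>path_verts n. R y = {}"
      using p(1) by (fastforce simp: R_def X_def)
    then show ?thesis using w by (auto simp: weight_def)
  next
    case False
    then have w: "weight X = 2" using aX by (auto simp: weight_def)
    \<comment> \<open>Makes offsets up to 3 available for the reply; offset 4 is selected only when
      \<open>a\<close> itself has offset at least 4.\<close>
    have big: "5 * j + 3 \<le> n"
    proof (rule ccontr)
      assume "\<not> ?thesis"
      then have "X \<subseteq> {5 * j + 1, 5 * j + 1 + 1}" using Xn by (auto simp: X_def block_def)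
      then show False using False by blast
    qed
    \<comment> \<open>Offsets within block \<open>j\<close>: Dominator selects offset \<open>k\<close>, and only \<open>t\<close> and \<open>t + e\<close> may survive.\<close>
    have reply: "\<exists>y\<in>path_verts n. weight (R y) \<le> 1"
      if "5 * j + k \<le> n" "1 \<le> k" "e = 1 \<or> e = 2"
        and z: "\<And>z. 1 \<le> z \<Longrightarrow> z \<le> 5 \<Longrightarrow> z + 1 \<noteq> k \<Longrightarrow> z \<noteq> k + 1 \<Longrightarrow> 5 * j + z + 1 \<noteq> x \<Longrightarrow>
          5 * j + z \<noteq> x + 1 \<Longrightarrow> z = t \<or> z = t + e" for k t e
    proof
      show "5 * j + k \<in> path_verts n" using that by (simp add: path_verts_def)
      have "v = 5 * j + t \<or> v = 5 * j + t + e" if v: "v \<in> R (5 * j + k)" for v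
      proof -
        have "1 \<le> v - 5 * j" "v - 5 * j \<le> 5" "v = 5 * j + (v - 5 * j)"
          "v \<noteq> x - 1" "v \<noteq> x + 1" "v \<noteq> 5 * j + k - 1" "v \<noteq> 5 * j + k + 1"
          using v by (auto simp: R_def block_def)
        then show ?thesis using z[of "v - 5 * j"] by linarith
      qed
      then have "R (5 * j + k) \<subseteq> {5 * j + t, 5 * j + t + e}" by blast
      then show "weight (R (5 * j + k)) \<le> 1"
        using \<open>e = 1 \<or> e = 2\<close> weight_le_1I by metis
    qed
    have a_block: "5 * j + 1 \<le> a" "a \<le> 5 * j + 5" using aX by (auto simp: X_def block_def)
    then have a_block': "a = 5 * j + 1 \<or> a = 5 * j + 2 \<or> a = 5 * j + 3 \<or> a = 5 * j + 4 \<or> a = 5 * j + 5"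
      by linarith
    \<comment> \<open>Here \<open>x = a\<close> is a pass, and otherwise \<open>x\<close> covers
      \<open>a\<close>. The side of \<open>x\<close> is distinguished only at the middle offset,
      where it decides whether offset 1 or 5 is covered as well. The arguments of
      \<open>reply\<close> below are \<open>k\<close>, \<open>e\<close>, \<open>t\<close> in this
      order.\<close>
    consider "a = 5 * j + 1" "x = a"
      | "a = 5 * j + 1" "x \<noteq> a"
      | "a = 5 * j + 2" "x = a"
      | "a = 5 * j + 2" "x \<noteq> a"
      | "a = 5 * j + 3" "x = a"
      | "a = 5 * j + 3" "x < a"
      | "a = 5 * j + 3" "x > a"
      | "a = 5 * j + 4" "x = a"
      | "a = 5 * j + 4" "x \<noteq> a"
      | "a = 5 * j + 5" "x = a"
      | "a = 5 * j + 5" "x \<noteq> a"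
      using a_block' linorder_less_linear[of x a] by blast
    then have "\<exists>y\<in>path_verts n. weight (R y) \<le> 1"
    proof cases
      case 1
      then show ?thesis using move_cases a_n big by (intro reply[of 2 1 4]) linarith+
    next
      case 2
      then show ?thesis using move_cases a_n big by (intro reply[of 3 2 3]) linarith+
    next
      case 3
      then show ?thesis using move_cases a_n big by (intro reply[of 3 1 5]) linarith+
    next
      case 4
      then show ?thesis using move_cases a_n big by (intro reply[of 2 1 4]) linarith+
    next
      case 5
      then show ?thesis using move_cases a_n big by (intro reply[of 2 1 5]) linarith+
    next
      case 6
      then show ?thesis using move_cases a_n big by (intro reply[of 3 1 5]) linarith+
    next
      case 7
      then show ?thesis using move_cases a_n big by (intro reply[of 3 1 1]) linarith+
    next
      case 8
      then show ?thesis using move_cases a_n big by (intro reply[of 3 1 1]) linarith+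
    next
      case 9
      then show ?thesis using move_cases a_n big by (intro reply[of 4 1 1]) linarith+
    next
      case 10
      then show ?thesis using move_cases a_n big by (intro reply[of 4 1 1]) linarith+
    next
      case 11
      then show ?thesis using move_cases a_n big by (intro reply[of 3 2 1]) linarith+
    qed
    then show ?thesis using w less_Suc_eq_le one_add_one plus_1_eq_Suc by metis
  qed
  then obtain y where y: "y \<in> path_verts n" "weight (R y) < weight X" by blast
  then have "weight ((U - open_nbh x - open_nbh y) \<inter> block j) < weight (U \<inter> block j)"
    unfolding R[OF y(1)] X_def[symmetric] by blast
  then show ?thesis using j y(1) by blast
qed

text \<open>The path meets \<open>(n + 4) div 5\<close> blocks of weight at most 2 each; every unit
  of weight costs two moves, and Dominator's first move is the extra one.\<close>

lemma LL_game_number_path_le: "LL_game_number \<le> enat (4 * ((n + 4) div 5) + 1)"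
proof -
  define W where "W U = (\<Sum>j<(n + 4) div 5. weight (U \<inter> block j))" for U
  have "LL_game_number \<le> enat (2 * W (path_verts n) + 1)"
  proof (rule LL_game_number_le_potential)
    show "W A \<le> W B" if "A \<subseteq> B" for A B
      unfolding W_def using that by (auto intro!: sum_mono weight_mono)
  next
    fix U x
    assume "U \<subseteq> path_verts n" "x \<in> path_verts n" "closed_nbh x \<inter> U \<noteq> {}"
    then obtain j y where jy: "j < (n + 4) div 5" "y \<in> path_verts n"
      "weight ((U - open_nbh x - open_nbh y) \<inter> block j) < weight (U \<inter> block j)"
      using block_reply by blast
    \<comment> \<open>The weight drops in block \<open>j\<close> and, by monotonicity, grows in no
      other block.\<close>
    then have "W (U - open_nbh x - open_nbh y) < W U"
      unfolding W_def by (intro sum_strict_mono_ex1) (auto intro!: weight_mono)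
    then show "\<exists>y\<in>path_verts n. W (U - open_nbh x - open_nbh y) < W U"
      using jy by blast
  qed
  moreover have "W (path_verts n) \<le> (\<Sum>j<(n + 4) div 5. 2)"
    unfolding W_def by (intro sum_mono weight_le_2)
  ultimately show ?thesis
    by (simp add: order.trans)
qed

end

subsection \<open>Staller's strategy\<close>

definition lonely :: "nat set \<Rightarrow> nat \<Rightarrow> bool" where
  "lonely U v \<longleftrightarrow> v \<in> U \<and> v - 1 \<notin> U \<and> v + 1 \<notin> U"

text \<open>The only places where Dominator can cover two vertices without making the selected
  vertex lonely.\<close>

definition unit_gap :: "nat set \<Rightarrow> nat \<Rightarrow> bool" where
  "unit_gap U v \<longleftrightarrow> v \<notin> U \<and> v - 1 \<in> U \<and> v + 1 \<in> U"

text \<open>Invariant of the play: when Staller has no lonely vertex to pass on, there is no unit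
  gap either.\<close>

definition guarded :: "nat set \<Rightarrow> bool" where
  "guarded U \<longleftrightarrow> (\<forall>v. unit_gap U v \<longrightarrow> lonely U (v - 1) \<or> lonely U (v + 1))"

text \<open>A lonely vertex that stays uncovered stays lonely, so old gaps remain guarded. At a new
  gap \<open>v\<close> the selected vertex \<open>y\<close> is one of the two uncovered neighbours,
  and both its own neighbours have just been removed.\<close>

lemma guarded_Diff:
  assumes "guarded U" "0 \<notin> U" 
  shows "guarded (U - {y - 1, y + 1})"
  unfolding guarded_def
proof (intro allI impI)
  let ?U = "U - {y - 1, y + 1}"
  fix v assume v: "unit_gap ?U v"
  show "lonely ?U (v - 1) \<or> lonely ?U (v + 1)"
  proof (cases "v \<in> U")
    case False
    then have "lonely U (v - 1) \<or> lonely U (v + 1)"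
      using v assms by (auto simp: guarded_def unit_gap_def)
    then show ?thesis using v by (auto simp: unit_gap_def lonely_def)
  next
    case True
    have "v - 1 \<in> U" using v by (simp add: unit_gap_def)
    \<comment> \<open>Excludes the truncated case \<open>y = 0\<close> of
      \<open>v = y - 1\<close>.\<close>
    then have "0 < v - 1" using assms(2) by (metis gr0I)
    moreover have "v = y - 1 \<or> v = y + 1" using v True by (auto simp: unit_gap_def)
    ultimately have "y = v + 1 \<or> y = v - 1" by auto
    then have "lonely ?U y" using v True by (auto simp: lonely_def unit_gap_def)
    then show ?thesis using \<open>y = v + 1 \<or> y = v - 1\<close> by auto
  qed
qed

text \<open>As \<open>y\<close> is no unit gap, it is itself uncovered, and selecting it does not
  cover it.\<close>

lemma lonely_after_double:
  assumes "\<not> unit_gap U y" "y - 1 \<in> U" "y + 1 \<in> U" "0 \<notin> U"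
  shows "lonely (U - {y - 1, y + 1}) y"
  using assms by (cases y) (auto simp: unit_gap_def lonely_def)

text \<open>A new gap would have \<open>c\<close> as one of its uncovered neighbours.\<close>

lemma no_unit_gap_Diff:
  assumes "\<And>v. \<not> unit_gap U v" "c \<notin> U"
  shows "\<not> unit_gap (U - {c - 1, c + 1}) v"
  using assms(1)[of v] assms(2) by (cases c) (auto simp: unit_gap_def)

context path_game
begin

text \<open>Connectedness of the path: without such a boundary vertex, being covered would spread
  from one vertex in both directions. This supplies Staller's move when she cannot pass.\<close>

lemma ex_half_covered:
  assumes "U \<subseteq> path_verts n" "U \<noteq> {}" "U \<noteq> path_verts n"
  shows "\<exists>c\<in>path_verts n. c \<notin> U \<and> (c - 1 \<in> U \<or> c + 1 \<in> U)"
proof (rule ccontr)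
  assume "\<not> ?thesis"
  then have *: "c - 1 \<notin> U \<and> c + 1 \<notin> U" if "c \<in> path_verts n" "c \<notin> U" for c
    using that by blast
  obtain w where w: "w \<in> path_verts n" "w \<notin> U" using assms by blast
  have "k \<notin> U" if "w \<le> k" for k
    using that
  proof (induction rule: dec_induct)
    case base
    then show ?case by (rule w)
  next
    case (step k)
    then show ?case using *[of k] w assms(1) by (auto simp: path_verts_def)
  qed
  moreover have "k \<notin> U" if "k \<le> w" for k
    using that
  proof (induction rule: inc_induct)
    case base
    then show ?case by (rule w)
  next
    case (step k)
    then show ?case using *[of "Suc k"] w by (auto simp: path_verts_def)
  qed
  ultimately show False using assms(2) by (metis ex_in_conv nat_le_linear)
qed

lemma LL_game_number_path_ge: "enat ((4 * n - 10) div 5) \<le> LL_game_number"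
proof -
  let ?half = "\<lambda>U c. c \<in> path_verts n \<and> c \<notin> U \<and> (c - 1 \<in> U \<or> c + 1 \<in> U)"
  \<comment> \<open>The last branch keeps the move legal on the full vertex set, where no vertex is
    half covered.\<close>
  define s where "s h = (if \<exists>v. lonely (uncovered h) v then SOME v. lonely (uncovered h) v
    else if \<exists>c. ?half (uncovered h) c then SOME c. ?half (uncovered h) c
    else SOME v. legal_move h v)" for h
  have s_lonely: "lonely (uncovered h) (s h)" if "lonely (uncovered h) v" for h v
  proof -
    have "\<exists>v. lonely (uncovered h) v" using that by blast
    then show ?thesis using someI_ex[of "lonely (uncovered h)"] by (simp only: s_def if_True)
  qed
  have s_half: "?half (uncovered h) (s h)"
    if "\<And>v. \<not> lonely (uncovered h) v" "?half (uncovered h) c" for h c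
  proof -
    have "\<not> (\<exists>v. lonely (uncovered h) v)" and ex: "\<exists>c. ?half (uncovered h) c"
      using that by blast+
    then have "s h = (SOME c. ?half (uncovered h) c)" by (simp only: s_def if_True if_False)
    then show ?thesis using someI_ex[OF ex] by (simp only: simp_thms)
  qed
  have s: "s \<in> strategies"
  proof (rule strategiesI)
    fix h assume h: "uncovered h \<noteq> {}"
    consider (lonely) "\<exists>v. lonely (uncovered h) v"
      | (half) "\<And>v. \<not> lonely (uncovered h) v" "\<exists>c. ?half (uncovered h) c"
      | (other) "\<And>v. \<not> lonely (uncovered h) v" "\<not> (\<exists>c. ?half (uncovered h) c)"
      by blast
    then show "legal_move h (s h)"
    proof cases
      case lonely
      then have "s h \<in> uncovered h" using s_lonely by (auto simp: lonely_def)
      then show ?thesis using uncovered_subset by (auto simp: legal_move_iff closed_nbh_def)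
    next
      case half
      then have *: "?half (uncovered h) (s h)" using s_half by blast
      then obtain u where u: "u \<in> uncovered h" "u = s h - 1 \<or> u = s h + 1" by blast
      then have "u \<in> open_nbh (s h)"
        using * uncovered_subset[of h] by (auto simp: mem_open_nbh_iff path_verts_def)
      then show ?thesis using u * by (auto simp: legal_move_iff closed_nbh_def)
    next
      case other
      then have "\<not> (\<exists>v. lonely (uncovered h) v)" by blast
      then have "s h = (SOME v. legal_move h v)"
        using other(2) by (simp only: s_def if_False)
      moreover have "\<exists>v. legal_move h v" using h ex_legal_move_iff[of h] by blast
      ultimately show ?thesis using someI_ex[of "legal_move h"] by simp
    qed
  qed
  have finite_uncovered: "finite (uncovered h)" for h
    using finite_subset[OF uncovered_subset finite_verts] .
  have zero: "0 \<notin> uncovered h" for h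
    using uncovered_subset[of h] by (auto simp: path_verts_def)
  have card_two: "card U \<le> card (U - {a, b}) + 2" for U and a b :: nat
    using diff_card_le_card_Diff[of "{a, b}" U] card_insert_le_m1[of 2 "{b}" a] by simp
  have card_one: "card U \<le> card (U - {y - 1, y + 1}) + 1" if "\<not> (y - 1 \<in> U \<and> y + 1 \<in> U)" for U and y :: nat
  proof -
    have "U - {y - 1, y + 1} = U - {y - 1} \<or> U - {y - 1, y + 1} = U - {y + 1}" using that by auto
    moreover have "card U \<le> card (U - {z}) + 1" for z
      using diff_card_le_card_Diff[of "{z}" U] by simp
    ultimately show ?thesis by metis
  qed
  \<comment> \<open>A reserve of 2, present while there is no unit gap. It is what a round covering
    three vertices falls short of, since 4 * 3 = 2 * 5 + 2.\<close>
  let ?slack = "\<lambda>U. if \<exists>v. unit_gap U v then 0 else 2 :: nat"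
  show ?thesis
  proof (rule LL_game_number_geI[OF s])
    fix d assume d: "d \<in> strategies"
    let ?p = "play d s"
    \<comment> \<open>The second alternative is a finished play; its margin 10 = 4 * 2 + 2 allows
      for two vertices covered by a last move of Dominator and for the slack.\<close>
    have inv: "length (?p (2 * m)) = 2 * m \<and> guarded (uncovered (?p (2 * m))) \<and>
        4 * n \<le> 4 * card (uncovered (?p (2 * m))) + 5 * length (?p (2 * m)) + ?slack (uncovered (?p (2 * m)))
      \<or> uncovered (?p (2 * m)) = {} \<and> 4 * n \<le> 5 * length (?p (2 * m)) + 10" for m
    proof (induction m)
      case 0
      have "\<not> unit_gap (path_verts n) v" for v by (auto simp: unit_gap_def path_verts_def)
      moreover have "card (path_verts n) = n" by (simp add: path_verts_def)
      ultimately show ?case by (simp add: guarded_def)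
    next
      case (Suc m)
      define h where "h = ?p (2 * m)"
      define U where "U = uncovered h"
      have two: "2 * Suc m = Suc (Suc (2 * m))" by simp
      show ?case
      proof (cases "U = {}")
        case True
        then have "?p (2 * Suc m) = h"
          unfolding two h_def U_def by (metis play_over)
        then show ?thesis using Suc True by (auto simp: h_def U_def split: if_splits)
      next
        case False
        define y where "y = d h"
        define h1 where "h1 = h @ [y]"
        define U1 where "U1 = uncovered h1"
        have len: "length h = 2 * m" and guarded: "guarded U"
          and count: "4 * n \<le> 4 * card U + 5 * length h + ?slack U"
          using Suc False by (auto simp: h_def U_def)
        have p1: "?p (Suc (2 * m)) = h1"
          using len False play_Suc_eq[of d s "2 * m"] by (simp add: h_def h1_def y_def U_def)
        have "legal_move h y"
          unfolding y_def h_def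
          by (rule legal_move_strategy[OF d legal_position_play[OF d s]])
            (use False h_def U_def in simp)
        then have y: "y \<in> path_verts n" by (simp add: legal_move_iff)
        have U1: "U1 = U - {y - 1, y + 1}"
          using Diff_open_nbh[OF uncovered_subset y] by (simp add: U1_def U_def h1_def uncovered_snoc)
        have guarded1: "guarded U1"
          unfolding U1 by (rule guarded_Diff[OF guarded]) (simp add: U_def zero)
        have card1: "card U \<le> card U1 + 2" unfolding U1 by (rule card_two)
        show ?thesis
        proof (cases "U1 = {}")
          case True
          then have "?p (2 * Suc m) = h1" unfolding two U1_def using p1 play_over by metis
          moreover have "4 * n \<le> 5 * length h1 + 10"
            using count card1 True by (auto simp: h1_def split: if_splits)
          ultimately show ?thesis using True by (simp add: U1_def)
        next
          case False
          define x where "x = s h1"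
          define h2 where "h2 = h1 @ [x]"
          define U2 where "U2 = uncovered h2"
          have p2: "?p (2 * Suc m) = h2"
            unfolding two using p1 False len play_Suc_eq[of d s "Suc (2 * m)"]
            by (simp add: h1_def h2_def x_def U1_def)
          have "legal_move h1 x"
            using legal_move_strategy[OF s legal_position_play[OF d s, of "Suc (2 * m)"]] p1 False
            by (simp add: x_def U1_def)
          then have x: "x \<in> path_verts n" by (simp add: legal_move_iff)
          have U2: "U2 = U1 - {x - 1, x + 1}"
            using Diff_open_nbh[OF uncovered_subset x] by (simp add: U2_def U1_def h2_def uncovered_snoc)
          have guarded2: "guarded U2"
            unfolding U2 by (rule guarded_Diff[OF guarded1]) (simp add: U1_def zero)
          \<comment> \<open>If Staller passes, the round covers at most two vertices. Otherwise it
            ends without unit gaps and hence with slack 2; it covers three vertices only if it began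
            with a gap, that is, with slack 0.\<close>
          have "4 * card U + ?slack U \<le> 4 * card U2 + 10 + ?slack U2"
          proof (cases "\<exists>v. lonely U1 v")
            case True
            then have "lonely U1 x" using s_lonely by (auto simp: U1_def x_def)
            then have "U2 = U1" by (auto simp: U2 lonely_def)
            then show ?thesis using card1 by auto
          next
            case no_lonely: False
            then have no_gap: "\<not> unit_gap U1 v" for v using guarded1 by (auto simp: guarded_def)
            obtain u where "u \<in> path_verts n" "u \<in> open_nbh y"
              using ex_neighbour[OF y] open_nbh_sym by blast
            then have "U1 \<noteq> path_verts n" by (auto simp: U1_def h1_def uncovered_snoc)
            then obtain c where "?half U1 c"
              using ex_half_covered[of U1] False uncovered_subset by (auto simp: U1_def)
            then have half: "?half U1 x"
              using s_half[of h1 c] no_lonely by (simp add: U1_def x_def)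
            have "\<not> (x - 1 \<in> U1 \<and> x + 1 \<in> U1)" using half no_gap by (auto simp: unit_gap_def)
            then have card2: "card U1 \<le> card U2 + 1" unfolding U2 by (rule card_one)
            have "\<not> unit_gap U2 v" for v
              unfolding U2 using no_gap half by (intro no_unit_gap_Diff) auto
            then have slack2: "?slack U2 = 2" by simp
            show ?thesis
            proof (cases "\<exists>v. unit_gap U v")
              case True
              then show ?thesis using card1 card2 slack2 by simp
            next
              case False
              \<comment> \<open>Covering both neighbours would have left \<open>y\<close> lonely,
                and Staller would have passed.\<close>
              then have "\<not> (y - 1 \<in> U \<and> y + 1 \<in> U)"
                using lonely_after_double[of U y] no_lonely zero by (auto simp: U1 U_def)
              then have "card U \<le> card U1 + 1" unfolding U1 by (rule card_one)
              then show ?thesis using card2 slack2 False by simp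
            qed
          qed
          then have "4 * n \<le> 4 * card U2 + 5 * length h2 + ?slack U2"
            using count by (simp add: h1_def h2_def)
          then show ?thesis using p2 guarded2 len by (simp add: U2_def h1_def h2_def)
        qed
      qed
    qed
    show "\<exists>k. (4 * n - 10) div 5 \<le> length (?p k)"
      \<comment> \<open>After \<open>2 * n\<close> steps the play either has ended or has length
        \<open>2 * n\<close>, which already exceeds the bound.\<close>
      using inv[of n] by (intro exI[of _ "2 * n"]) linarith
  qed
qed

end

theorem theorem5p5:
  "\<exists>C::real. \<forall>n::nat. n \<ge> 2 \<longrightarrow>
     (\<exists>c::real. \<bar>c\<bar> \<le> C \<and>
        ereal_of_enat (gamma_LLg_path n) = ereal (4 * real n / 5 + c))"
proof (rule exI[of _ 5], intro allI impI)
  fix n :: nat assume "n \<ge> 2"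
  then interpret path_game n by unfold_locales
  obtain g where g: "LL_game_number = enat g" "g \<le> 4 * ((n + 4) div 5) + 1"
    using LL_game_number_path_le by (cases LL_game_number) auto
  \<comment> \<open>Rounding in the two divisions by 5 costs at most 4 here and 16 in the upper
    estimate, so the deviation lies between -14/5 and 21/5.\<close>
  have "4 * n \<le> 5 * g + 14" using LL_game_number_path_ge g by simp
  moreover have "5 * g \<le> 4 * n + 21" using g by linarith
  ultimately have "\<bar>real g - 4 * real n / 5\<bar> \<le> 5" by linarith
  then show "\<exists>c. \<bar>c\<bar> \<le> 5 \<and> ereal_of_enat (gamma_LLg_path n) = ereal (4 * real n / 5 + c)"
    by (intro exI[of _ "real g - 4 * real n / 5"]) (simp add: gamma_LLg_path_def g)
qed

end
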